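(* For each integer $k\ge 11$, there exists a Hamiltonian (i.e. closed) Euclidean threeleaper's tour on $C(2,k)=\{0,1\}^k$; that is, there exists an ordering $V_1,V_2,\dots,V_{2^k}$ of all the elements of $\{0,1\}^k$, each occurring exactly once, such that $\|V_i-V_{i+1}\|=\sqrt{9}$ for every $1\le i\le 2^k-1$ and $\|V_{2^k}-V_1\|=\sqrt{9}$.
   Context: For positive integers $n,k$, $C(n,k):=\{0,1,\dots,n-1\}^k$ and $\|\cdot\|$ is the Euclidean norm on $\mathbb{R}^k$. The $(a,b)$-leaper is the fairy chess piece that may jump between any two vertices of $C(n,k)$ whose Euclidean distance is exactly $\sqrt{a^2+b^2}$. The threeleaper is the $(0,3)$-leaper, so its jump length is $\sqrt{0^2+3^2}=\sqrt{9}=3$. A Euclidean tour of a leaper on $C(n,k)$ is a sequence listing every vertex of $C(n,k)$ exactly once in which any two consecutive vertices are at the leaper's jump distance. It is closed (Hamiltonian) if the last and the first vertices are also at the leaper's jump distance. *)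

theory Defs
  imports "HOL-Analysis.Analysis"
begin

text \<open>
  Vectors of \<open>\<real>\<^sup>k\<close> have type \<open>real ^ 'k\<close> with \<open>k = CARD('k)\<close>; the grid
  \<open>C(n,k) = {0, 1, ..., n - 1}\<^sup>k\<close> is the set \<open>grid n :: (real ^ 'k) set\<close>.
\<close>

definition grid :: "nat \<Rightarrow> (real ^ 'k) set" where
  "grid n = {x. \<forall>i. x $ i \<in> real ` {..<n}}"

definition leaper_move :: "nat \<Rightarrow> nat \<Rightarrow> real ^ 'k \<Rightarrow> real ^ 'k \<Rightarrow> bool" where
  "leaper_move a b x y \<longleftrightarrow> norm (x - y) = sqrt ((real a)\<^sup>2 + (real b)\<^sup>2)"

text \<open>
  A tour is a sequence \<open>V 1, ..., V (n ^ k)\<close>; values of \<open>V\<close> at other indices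
  are irrelevant.
\<close>

definition euclidean_tour :: "nat \<Rightarrow> nat \<Rightarrow> nat \<Rightarrow> (nat \<Rightarrow> real ^ 'k) \<Rightarrow> bool" where
  "euclidean_tour a b n V \<longleftrightarrow>
     bij_betw V {1..n ^ CARD('k)} (grid n) \<and>
     (\<forall>i\<in>{1..n ^ CARD('k) - 1}. leaper_move a b (V i) (V (i + 1)))"

definition closed_euclidean_tour :: "nat \<Rightarrow> nat \<Rightarrow> nat \<Rightarrow> (nat \<Rightarrow> real ^ 'k) \<Rightarrow> bool" where
  "closed_euclidean_tour a b n V \<longleftrightarrow>
     euclidean_tour a b n V \<and> leaper_move a b (V (n ^ CARD('k))) (V 1)"

lemma closed_threeleaper_tour_iff:
  fixes V :: "nat \<Rightarrow> real ^ 'k"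
  shows "closed_euclidean_tour 0 3 2 V \<longleftrightarrow>
     bij_betw V {1..2 ^ CARD('k)} {x. \<forall>i. x $ i \<in> {0, 1}} \<and>
     (\<forall>i\<in>{1..2 ^ CARD('k) - 1}. norm (V i - V (i + 1)) = sqrt 9) \<and>
     norm (V (2 ^ CARD('k)) - V 1) = sqrt 9"
proof -
  have "real ` {..<2} = {0, 1}"
    by (auto simp: numeral_2_eq_2 lessThan_Suc)
  then show ?thesis
    by (simp add: closed_euclidean_tour_def euclidean_tour_def leaper_move_def grid_def)
qed

end

theory Submission
  imports Defs
begin

text \<open>
  Identify \<open>{0,1}\<^sup>k\<close> with the subsets of the index set, a vector space over the field with two
  elements under symmetric difference; the squared Euclidean distance is the size of the symmetric
  difference. The reflected Gray code over \<open>k\<close> subsets of size 9 that generate everything lists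
  \<open>2\<^sup>k\<close> subsets covering the whole space, so each occurs exactly once, and consecutive ones differ
  by a generator. Generators: fix a set \<open>T\<close> of 10 indices and an 8-element subset \<open>D\<close> of it, and take
  \<open>T - {i}\<close> for \<open>i \<in> T\<close> and \<open>insert i D\<close> for \<open>i \<notin> T\<close>. The sum of all \<open>T - {i}\<close> is \<open>T\<close>, as \<open>|T|\<close> is
  even, which yields the singletons.
\<close>

fun gray :: "'a set list \<Rightarrow> 'a set list" where
  "gray [] = [{}]"
| "gray (B # Bs) = gray Bs @ rev (map (sym_diff B) (gray Bs))"

lemma length_gray: "length (gray Bs) = 2 ^ length Bs"
  by (induction Bs) auto

lemma gray_not_Nil [simp]: "gray Bs \<noteq> []"
  by (induction Bs) auto

lemma hd_gray: "hd (gray Bs) = {}"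
  by (induction Bs) auto

text \<open>Since the list starts at the empty set, this makes the return from the last entry to the
  first a generator step too, so the code is cyclic.\<close>

lemma last_gray_Cons: "last (gray (B # Bs)) = B"
  by (simp add: last_rev hd_map hd_gray)

text \<open>Translating by \<open>B\<close> keeps symmetric differences and reversing only swaps the
  two arguments, so both halves inherit the property. At the junction a set meets its own translate,
  and the difference is \<open>B\<close>.\<close>

lemma successively_gray:
  "successively (\<lambda>A B. sym_diff A B \<in> set Bs) (gray Bs)"
proof (induction Bs)
  case (Cons B Bs)
  have "sym_diff (sym_diff B X) (sym_diff B Y) = sym_diff Y X" for X Y
    by blast
  then have "successively (\<lambda>X Y. sym_diff X Y \<in> set (B # Bs)) (rev (map (sym_diff B) (gray Bs)))"
    using Cons.IH
    by (auto simp: successively_rev successively_map elim!: successively_mono)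
  moreover have "sym_diff X (sym_diff B X) = B" for X
    by blast
  then have "sym_diff (last (gray Bs)) (hd (rev (map (sym_diff B) (gray Bs)))) = B"
    by (simp add: hd_rev last_map)
  ultimately show ?case
    using Cons.IH by (auto simp: successively_append_iff elim!: successively_mono)
qed auto

lemma empty_in_gray: "{} \<in> set (gray Bs)"
  by (induction Bs) auto

lemma generator_in_gray: "B \<in> set Bs \<Longrightarrow> B \<in> set (gray Bs)"
proof (induction Bs)
  case (Cons A Bs)
  have "A \<in> sym_diff A ` set (gray Bs)"
    using empty_in_gray[of Bs] by (intro rev_image_eqI[of "{}"]) auto
  with Cons show ?case by auto
qed auto

text \<open>The entries form the span of the generators: each new \<open>B\<close> replaces a
  subspace by its union with the coset through \<open>B\<close>, and \<open>mem\<close> states this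
  union as a membership test.\<close>

lemma sym_diff_in_gray:
  "X \<in> set (gray Bs) \<Longrightarrow> Y \<in> set (gray Bs) \<Longrightarrow> sym_diff X Y \<in> set (gray Bs)"
proof (induction Bs arbitrary: X Y)
  case (Cons B Bs)
  let ?S = "set (gray Bs)"
  have mem: "Z \<in> set (gray (B # Bs)) \<longleftrightarrow> Z \<in> ?S \<or> sym_diff B Z \<in> ?S" for Z
  proof -
    have "sym_diff B (sym_diff B W) = W" for W
      by blast
    then have "Z \<in> sym_diff B ` ?S \<longleftrightarrow> sym_diff B Z \<in> ?S"
      by (metis (no_types, lifting) image_iff)
    then show ?thesis by simp
  qed
  have eqs: "sym_diff (sym_diff B X) Y = sym_diff B (sym_diff X Y)"
    "sym_diff X (sym_diff B Y) = sym_diff B (sym_diff X Y)"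
    "sym_diff (sym_diff B X) (sym_diff B Y) = sym_diff X Y"
    by blast+
  from Cons.prems show ?case
    unfolding mem using Cons.IH eqs by metis
qed auto

lemma eq_UNIV_if_sym_diff_closed:
  fixes S :: "'a::finite set set"
  assumes "{} \<in> S" "\<And>X Y. X \<in> S \<Longrightarrow> Y \<in> S \<Longrightarrow> sym_diff X Y \<in> S" "\<And>i. {i} \<in> S"
  shows "S = UNIV"
proof -
  have "X \<in> S" for X
    using finite[of X]
  proof (induction X rule: finite_induct)
    case (insert x F)
    then have "insert x F = sym_diff {x} F" by blast
    with insert assms show ?case by metis
  qed (use assms in auto)
  then show ?thesis by blast
qed

text \<open>Modulo 2, \<open>T - {i}\<close> is \<open>T + {i}\<close>, so summing over
  \<open>i\<close> in \<open>A\<close> gives \<open>card A\<close> copies of \<open>T\<close> plus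
  \<open>A\<close>.\<close>

lemma sum_of_codim_one_subsets:
  assumes "{} \<in> S" "\<And>X Y. X \<in> S \<Longrightarrow> Y \<in> S \<Longrightarrow> sym_diff X Y \<in> S" "\<And>i. i \<in> T \<Longrightarrow> T - {i} \<in> S"
    and "finite A" "A \<subseteq> T"
  shows "(if even (card A) then A else T - A) \<in> S"
  using assms(4,5)
proof (induction A rule: finite_induct)
  case (insert x F)
  have "sym_diff F (T - {x}) = T - insert x F" "sym_diff (T - F) (T - {x}) = insert x F"
    using insert.hyps insert.prems by blast+
  with insert assms(2)[OF insert.IH assms(3)[of x]] show ?case
    by (auto split: if_splits)
qed (use assms in auto)

text \<open>For odd \<open>m\<close> the sizes \<open>m + 1\<close> of \<open>T\<close> and
  \<open>m - 1\<close> of \<open>D\<close> are even, so both sets are sums of generators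
  \<open>T - {i}\<close>. Then \<open>T\<close> yields the singletons inside \<open>T\<close>, and
  \<open>D\<close> those outside.\<close>

lemma generating_sets_exist:
  assumes "odd m" "m < CARD('k::finite)"
  obtains Bs :: "'k::finite set list" where
    "length Bs = CARD('k)" "\<And>B. B \<in> set Bs \<Longrightarrow> card B = m" "set (gray Bs) = UNIV"
proof -
  obtain T :: "'k set" where T: "card T = Suc m" "finite T"
    using obtain_subset_with_card_n[of "Suc m" "UNIV :: 'k set"] assms(2) by auto
  obtain D where D: "D \<subseteq> T" "card D = m - 1"
    using obtain_subset_with_card_n[of "m - 1" T] T by (metis diff_le_self le_Suc_eq)
  obtain xs :: "'k list" where xs: "set xs = UNIV" "distinct xs"
    using finite_distinct_list[of "UNIV :: 'k set"] by auto
  \<comment> \<open>One generator per index makes their number equal to the dimension.\<close>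
  define f where "f i = (if i \<in> T then T - {i} else insert i D)" for i
  define Bs where "Bs = map f xs"
  let ?S = "set (gray Bs)"
  have len: "length Bs = CARD('k)"
    using distinct_card[OF xs(2)] by (simp add: Bs_def xs)
  have size: "card B = m" if "B \<in> set Bs" for B
    using that T D assms(1) by (auto simp: Bs_def f_def card_insert_if odd_pos)
  have f: "f i \<in> ?S" for i
    by (rule generator_in_gray) (simp add: Bs_def xs)
  have fT: "T - {i} \<in> ?S" if "i \<in> T" for i
    using f[of i] that by (simp add: f_def)
  note sums = sum_of_codim_one_subsets[OF empty_in_gray[of Bs] sym_diff_in_gray[of _ Bs] fT]
  have even_sub: "A \<in> ?S" if "A \<subseteq> T" "even (card A)" for A
    using sums[of A] that by (simp split: if_splits)
  have "{i} \<in> ?S" for i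
  proof (cases "i \<in> T")
    case True
    then have "sym_diff T (T - {i}) = {i}" by blast
    moreover have "T \<in> ?S" using T assms(1) by (intro even_sub) auto
    ultimately show ?thesis using sym_diff_in_gray[OF _ fT[OF True]] by metis
  next
    case False
    then have "sym_diff (f i) D = {i}" using D by (auto simp: f_def)
    moreover have "D \<in> ?S" using D assms(1) by (intro even_sub) auto
    ultimately show ?thesis using sym_diff_in_gray[OF f[of i]] by metis
  qed
  then have "?S = UNIV"
    by (intro eq_UNIV_if_sym_diff_closed empty_in_gray sym_diff_in_gray)
  with len size show ?thesis by (rule that)
qed

definition indicator_vec :: "'k set \<Rightarrow> real ^ 'k" where
  "indicator_vec A = (\<chi> i. indicator A i)"

lemma norm_indicator_vec_diff:
  "norm (indicator_vec A - indicator_vec B) = sqrt (card (sym_diff A B))"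
proof -
  have "(\<Sum>i\<in>UNIV. (indicator A i - indicator B i :: real)\<^sup>2) = (\<Sum>i\<in>UNIV. indicator (sym_diff A B) i)"
    by (intro sum.cong) (auto simp: indicator_def)
  also have "\<dots> = card (sym_diff A B)"
    using Indicator_Function.sum_mult_indicator[of UNIV "\<lambda>_. 1 :: real" "sym_diff A B"] by simp
  finally show ?thesis
    by (simp add: norm_vec_def L2_set_def indicator_vec_def)
qed

lemma bij_betw_indicator_vec:
  "bij_betw indicator_vec UNIV {x :: real ^ 'k. \<forall>i. x $ i \<in> {0, 1}}"
  by (rule bij_betw_byWitness[where f' = "\<lambda>x. {i. x $ i = 1}"])
     (auto simp: indicator_vec_def vec_eq_iff indicator_def)

theorem theorem3p2:
  assumes "CARD('k::finite) \<ge> 11"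
  shows "\<exists>V :: nat \<Rightarrow> real ^ 'k. closed_euclidean_tour 0 3 2 V"
proof -
  obtain Bs :: "'k set list" where Bs: "length Bs = CARD('k)"
    "\<And>B. B \<in> set Bs \<Longrightarrow> card B = 9" "set (gray Bs) = UNIV"
    using generating_sets_exist[of 9, where 'k = 'k] assms by auto
  define N :: nat where "N = 2 ^ CARD('k)"
  \<comment> \<open>Tours are indexed from 1 and lists from 0, hence the shift.\<close>
  define V where "V i = (indicator_vec (gray Bs ! (i - 1)) :: real ^ 'k)" for i
  have len: "length (gray Bs) = N" and "N > 0"
    by (simp_all add: length_gray Bs N_def)
  \<comment> \<open>Counting stands in for a proof that the generators are linearly
    independent.\<close>
  have "distinct (gray Bs)"
    using len by (intro card_distinct) (simp add: Bs N_def card_UNIV_set)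
  then have "bij_betw ((!) (gray Bs)) {..<N} UNIV"
    using bij_betw_nth[of "gray Bs"] len Bs by simp
  moreover have "bij_betw (\<lambda>i. i - 1) {1..N} {..<N}"
    by (rule bij_betw_byWitness[where f' = Suc]) auto
  ultimately have "bij_betw V {1..N} {x. \<forall>i. x $ i \<in> {0, 1}}"
    unfolding V_def
    using bij_betw_trans[OF bij_betw_trans bij_betw_indicator_vec] by (fastforce simp: comp_def)
  moreover have "norm (V i - V (i + 1)) = sqrt 9" if "i \<in> {1..N - 1}" for i
  proof -
    have "sym_diff (gray Bs ! (i - 1)) (gray Bs ! i) \<in> set Bs"
      using successively_gray[of Bs] that len
      by (auto simp: successively_conv_nth dest: spec[of _ "i - 1"])
    then show ?thesis by (simp add: V_def norm_indicator_vec_diff Bs(2))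
  qed
  moreover have "norm (V N - V 1) = sqrt 9"
  proof -
    obtain B Bs' where "Bs = B # Bs'"
      using Bs(1) by (cases Bs) auto
    then have "gray Bs ! (N - 1) = B" "B \<in> set Bs"
      using last_gray_Cons[of B Bs'] last_conv_nth[of "gray Bs"] len by auto
    moreover have "gray Bs ! 0 = {}"
      using hd_gray[of Bs] by (simp add: hd_conv_nth)
    ultimately show ?thesis by (simp add: V_def norm_indicator_vec_diff Bs(2))
  qed
  ultimately show ?thesis
    unfolding closed_threeleaper_tour_iff N_def by blast
qed

end
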